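(* Let $\varphi\in H^\infty$ and suppose that $$\lim_{\vartheta\to0^+}\ \operatorname*{ess\,sup}_{\Gamma(\vartheta)\cap L_\varphi^-(1)}|\varphi| = 0,$$ and that there exist a sequence $(\vartheta_n)_{n\ge1}$ with $\vartheta_n\to0^+$ and positive constants $a,b$ such that for all $n$, $$|\Gamma(\vartheta_n)\cap L_\varphi^-(1)|\ge a|\Gamma(\vartheta_n)| \quad\text{and}\quad |\Gamma(\vartheta_n)\cap L_\varphi^+(1)|\ge b|\Gamma(\vartheta_n)|.$$ Then $\varphi$ is saturated.
   Context: $\mathbb{T}$ is the unit circle with normalized Lebesgue arc length measure, and $|E|$ denotes the measure of $E\subseteq\mathbb{T}$. $H^p$ ($1\le p\le\infty$) is the subspace of $L^p(\mathbb{T})$ of functions with Fourier coefficients supported on $\{0,1,2,\dots\}$, and $H^\infty_0$ is the subspace of $H^\infty$ of functions vanishing at the origin. A function $\varphi\in H^\infty$ is saturated if $\|\varphi\|_\infty = \inf_{f\in H^\infty_0}\|\varphi-\overline{f}\|_\infty$. For a bounded $\psi$ and $0\le\delta\le1$, $L_\psi^+(\delta)=\{e^{i\theta}\in\mathbb{T}: |\psi(e^{i\theta})|\ge\|\psi\|_\infty\delta\}$ and $L_\psi^-(\delta)=\{e^{i\theta}\in\mathbb{T}: |\psi(e^{i\theta})|<\|\psi\|_\infty\delta\}$. For $0<\vartheta\le\pi$, $\Gamma(\vartheta)=\{e^{i\theta}: |\theta|\le\vartheta\}$. *)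

theory Defs
  imports "HOL-Analysis.Analysis" "HOL-Probability.Essential_Supremum"
begin

text \<open>The unit circle is parametrised by theta in [-pi, pi] via theta |-> e^(i theta).
  Functions on the circle are functions real => complex, only their values on [-pi,pi] matter.\<close>

definition T_meas :: "real measure" where
  "T_meas = restrict_space lebesgue {-pi..pi}"

definition arc_measure :: "real set \<Rightarrow> real" where
  "arc_measure E = measure lebesgue (E \<inter> {-pi..pi}) / (2 * pi)"

definition ess_sup_norm :: "(real \<Rightarrow> complex) \<Rightarrow> ereal" where
  "ess_sup_norm f = esssup T_meas (\<lambda>x. ereal (cmod (f x)))"

definition Linf :: "(real \<Rightarrow> complex) set" where
  "Linf = {f. f \<in> borel_measurable T_meas \<and> ess_sup_norm f < \<infinity>}"

definition norm_inf :: "(real \<Rightarrow> complex) \<Rightarrow> real" where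
  "norm_inf f = real_of_ereal (ess_sup_norm f)"

definition fourier_coeff :: "(real \<Rightarrow> complex) \<Rightarrow> int \<Rightarrow> complex" where
  "fourier_coeff f n =
     (LINT x:{-pi..pi}|lebesgue. f x * exp (- \<i> * of_int n * of_real x)) / of_real (2 * pi)"

definition Hinf :: "(real \<Rightarrow> complex) set" where
  "Hinf = {f \<in> Linf. \<forall>n<0. fourier_coeff f n = 0}"

definition Hinf0 :: "(real \<Rightarrow> complex) set" where
  "Hinf0 = {f \<in> Hinf. fourier_coeff f 0 = 0}"

definition saturated :: "(real \<Rightarrow> complex) \<Rightarrow> bool" where
  "saturated \<phi> \<longleftrightarrow> norm_inf \<phi> = (INF f\<in>Hinf0. norm_inf (\<lambda>x. \<phi> x - cnj (f x)))"

definition Lplus :: "(real \<Rightarrow> complex) \<Rightarrow> real \<Rightarrow> real set" where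
  "Lplus \<psi> \<delta> = {x\<in>{-pi..pi}. cmod (\<psi> x) \<ge> norm_inf \<psi> * \<delta>}"

definition Lminus :: "(real \<Rightarrow> complex) \<Rightarrow> real \<Rightarrow> real set" where
  "Lminus \<psi> \<delta> = {x\<in>{-pi..pi}. cmod (\<psi> x) < norm_inf \<psi> * \<delta>}"

definition Gamma_arc :: "real \<Rightarrow> real set" where
  "Gamma_arc \<theta> = {x\<in>{-pi..pi}. \<bar>x\<bar> \<le> \<theta>}"

text \<open>Essential supremum of |f| over a set E (0 if E is null).\<close>
definition esssup_on :: "real set \<Rightarrow> (real \<Rightarrow> complex) \<Rightarrow> ereal" where
  "esssup_on E f = esssup T_meas (\<lambda>x. ereal (indicator E x * cmod (f x)))"

end

theory Submission
  imports Defs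
begin

text \<open>
  Suppose \<open>f\<close> in \<open>Hinf\<close> satisfies \<open>\<parallel>\<phi> - cnj f\<parallel> \<le> R < N = \<parallel>\<phi>\<parallel>\<close>. Put \<open>g = \<phi> f / N\<^sup>2\<close>. Where
  \<open>\<bar>\<phi>\<bar> = N\<close> we have \<open>\<bar>1 - g\<bar> \<le> R / N < 1\<close>, and on the rest of a small arc \<open>g\<close> is close to \<open>0\<close>.
  Hence for large \<open>k\<close> the function \<open>h = (1 - g)^k\<close> in \<open>Hinf\<close> is, near the point \<open>1\<close>, uniformly
  close to the indicator of \<open>S = Lminus \<phi> 1\<close>. Poisson integrals are multiplicative on \<open>Hinf\<close>, so
  with \<open>m\<close> the harmonic measure of \<open>S\<close> seen from the point \<open>1 - \<theta> n\<close>, both \<open>h\<close> and \<open>h\<^sup>2\<close> have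
  Poisson integral close to \<open>m\<close>, whence \<open>m \<approx> m\<^sup>2\<close>. The density hypotheses keep \<open>m\<close> away from \<open>0\<close>
  and \<open>1\<close>, a contradiction.

  That \<open>Hinf\<close> is closed under products follows from the \<open>L\<^sup>2\<close> density of trigonometric polynomials:
  by Pythagoras, discarding the negative frequencies of an approximation to \<open>F\<close> in \<open>Hinf\<close> only
  improves it.
\<close>

subsection \<open>Bounded functions on the circle\<close>

lemma space_T_meas [simp]: "space T_meas = {-pi..pi}"
  by (simp add: T_meas_def space_restrict_space)

lemma sets_T_meas: "A \<in> sets T_meas \<longleftrightarrow> A \<in> sets lebesgue \<and> A \<subseteq> {-pi..pi}"
  by (auto simp: T_meas_def sets_restrict_space_iff)

lemma measure_T_meas: "A \<subseteq> {-pi..pi} \<Longrightarrow> measure T_meas A = measure lebesgue A"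
  by (simp add: T_meas_def measure_restrict_space)

lemma emeasure_T_meas: "emeasure T_meas {-pi..pi} = ennreal (2 * pi)"
  by (simp add: T_meas_def emeasure_restrict_space)

interpretation T: finite_measure T_meas
  by standard (simp add: emeasure_T_meas)

lemma measurable_T_meas [measurable (raw)]: "f \<in> borel_measurable borel \<Longrightarrow> f \<in> borel_measurable T_meas"
  unfolding T_meas_def
  by (intro measurable_restrict_space1 measurable_completion) simp

lemma AE_T_meas_lebesgue:
  assumes "AE x in lebesgue. P x"
  shows "AE x in T_meas. P x"
  unfolding T_meas_def using assms by (subst AE_restrict_space_iff) auto

lemma fourier_coeff_T_meas:
  "fourier_coeff f n = (LINT x|T_meas. f x * cis (- of_int n * x)) / of_real (2 * pi)"
proof -
  have "exp (- \<i> * of_int n * of_real x) = cis (- of_int n * x)" for x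
    by (simp add: cis_conv_exp algebra_simps)
  then show ?thesis
    unfolding fourier_coeff_def set_lebesgue_integral_def T_meas_def
    by (subst integral_restrict_space) auto
qed

lemma Linf_iff:
  "f \<in> Linf \<longleftrightarrow> f \<in> borel_measurable T_meas \<and> (\<exists>B. AE x in T_meas. cmod (f x) \<le> B)"
proof (intro iffI conjI)
  assume f: "f \<in> Linf"
  then show m: "f \<in> borel_measurable T_meas" by (simp add: Linf_def)
  have "ess_sup_norm f \<noteq> \<infinity>" using f by (auto simp: Linf_def)
  moreover have "AE x in T_meas. ereal (cmod (f x)) \<le> ess_sup_norm f"
    unfolding ess_sup_norm_def by (rule esssup_AE)
  ultimately have "AE x in T_meas. cmod (f x) \<le> real_of_ereal (ess_sup_norm f)"
    by (cases "ess_sup_norm f") auto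
  then show "\<exists>B. AE x in T_meas. cmod (f x) \<le> B" by blast
next
  assume f: "f \<in> borel_measurable T_meas \<and> (\<exists>B. AE x in T_meas. cmod (f x) \<le> B)"
  then obtain B where B: "AE x in T_meas. cmod (f x) \<le> B" and [measurable]: "f \<in> borel_measurable T_meas" by blast
  have "ess_sup_norm f \<le> ereal B"
    unfolding ess_sup_norm_def using B by (intro esssup_I) auto
  then have "ess_sup_norm f < \<infinity>" by (rule order_le_less_trans) simp
  then show "f \<in> Linf" using f by (simp add: Linf_def)
qed

lemma Linf_measurable [measurable_dest]: "f \<in> Linf \<Longrightarrow> f \<in> borel_measurable T_meas"
  by (simp add: Linf_iff)

lemma LinfE:
  assumes "f \<in> Linf"
  obtains B where "B > 0" "AE x in T_meas. cmod (f x) \<le> B"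
proof -
  obtain B where B: "AE x in T_meas. cmod (f x) \<le> B" using assms by (auto simp: Linf_iff)
  show thesis
    by (rule that[of "max 1 B"]) (use B in auto)
qed

lemma LinfI:
  assumes "f \<in> borel_measurable T_meas" "\<And>x. cmod (f x) \<le> B"
  shows "f \<in> Linf"
  using assms by (auto simp: Linf_iff)

lemma Linf_norm_inf:
  assumes "f \<in> Linf"
  shows "AE x in T_meas. cmod (f x) \<le> norm_inf f" "norm_inf f \<ge> 0"
proof -
  have [measurable]: "f \<in> borel_measurable T_meas" using assms by (simp add: Linf_iff)
  \<comment> \<open>The circle has positive measure, so the essential supremum of the constant 0 is
    0 rather than -\<infinity>. The norm is therefore finite and nonnegative, and
    \<open>real_of_ereal\<close> loses nothing.\<close>
  have "esssup T_meas (\<lambda>x. 0 :: ereal) \<le> ess_sup_norm f"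
    unfolding ess_sup_norm_def by (rule esssup_mono) auto
  then have "0 \<le> ess_sup_norm f"
    by (subst (asm) esssup_const) (auto simp: emeasure_T_meas)
  moreover have "ess_sup_norm f < \<infinity>" using assms by (simp add: Linf_def)
  ultimately have e: "ess_sup_norm f = ereal (norm_inf f)" and n: "norm_inf f \<ge> 0"
    by (auto simp: norm_inf_def ereal_real' real_of_ereal_pos)
  show "norm_inf f \<ge> 0" by (rule n)
  show "AE x in T_meas. cmod (f x) \<le> norm_inf f"
    using esssup_AE[of "\<lambda>x. ereal (cmod (f x))" T_meas] e by (simp add: ess_sup_norm_def)
qed

lemma Linf_add [intro]:
  assumes "f \<in> Linf" "g \<in> Linf"
  shows "(\<lambda>x. f x + g x) \<in> Linf"
proof -
  obtain B C where "AE x in T_meas. cmod (f x) \<le> B" "AE x in T_meas. cmod (g x) \<le> C"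
    using assms by (auto simp: Linf_iff)
  then have "AE x in T_meas. cmod (f x + g x) \<le> B + C"
    by eventually_elim (meson add_mono norm_triangle_le)
  then show ?thesis using assms by (auto simp: Linf_iff)
qed

lemma Linf_mult [intro]:
  assumes "f \<in> Linf" "g \<in> Linf"
  shows "(\<lambda>x. f x * g x) \<in> Linf"
proof -
  obtain C where "AE x in T_meas. cmod (g x) \<le> C"
    using assms by (auto simp: Linf_iff)
  moreover obtain B where "B > 0" "AE x in T_meas. cmod (f x) \<le> B"
    using assms(1) by (rule LinfE)
  note this(2)
  ultimately have "AE x in T_meas. cmod (f x * g x) \<le> B * C"
    by eventually_elim (use \<open>B > 0\<close> in \<open>simp add: norm_mult mult_mono\<close>)
  then show ?thesis using assms by (auto simp: Linf_iff)
qed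

lemma Linf_const [intro, simp]: "(\<lambda>x. c) \<in> Linf"
  by (rule LinfI[where B = "cmod c"]) auto

lemma Linf_diff [intro]:
  assumes "f \<in> Linf" "g \<in> Linf"
  shows "(\<lambda>x. f x - g x) \<in> Linf"
  using Linf_add[OF assms(1) Linf_mult[OF Linf_const[of "-1"] assms(2)]] by simp

lemma Linf_cnj [intro]: "f \<in> Linf \<Longrightarrow> (\<lambda>x. cnj (f x)) \<in> Linf"
  unfolding Linf_iff
  using measurable_compose[OF _ borel_measurable_continuous_onI[OF continuous_on_cnj[OF continuous_on_id]]]
  by auto

lemma borel_measurable_cis [measurable]: "cis \<in> borel_measurable borel"
  by (intro borel_measurable_continuous_onI continuous_intros)

lemma Linf_cis [intro, simp]: "(\<lambda>x. cis (c * x)) \<in> Linf"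
  by (rule LinfI[where B = 1]) auto

lemma Linf_integrable: "f \<in> Linf \<Longrightarrow> integrable T_meas f"
  by (auto simp: Linf_iff intro: T.integrable_const_bound)

section \<open>Fourier coefficients and orthogonality of exponentials\<close>

text \<open>Up to the factor 1/(2 pi), the coefficient at -(n+1) is the integral against the
  exponential of frequency n+1. Indexing by naturals suits the recursions on n below.\<close>

lemma Hinf_iff:
  "f \<in> Hinf \<longleftrightarrow> f \<in> Linf \<and> (\<forall>n::nat. (LINT x|T_meas. f x * cis (real (Suc n) * x)) = 0)"
proof -
  have "(\<forall>n<0. fourier_coeff f n = 0) \<longleftrightarrow> (\<forall>n::nat. (LINT x|T_meas. f x * cis (real (Suc n) * x)) = 0)"
    (is "?L \<longleftrightarrow> ?R")
  proof
    assume L: ?L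
    show ?R
    proof
      fix n
      have "fourier_coeff f (- int (Suc n)) = 0" using L by simp
      then show "(LINT x|T_meas. f x * cis (real (Suc n) * x)) = 0"
        by (simp add: fourier_coeff_T_meas algebra_simps)
    qed
  next
    assume R: ?R
    show ?L
    proof (intro allI impI)
      fix n :: int assume "n < 0"
      then obtain k where "n = - int (Suc k)"
        by (metis negD)
      moreover from this have "- of_int n = real (Suc k)" by simp
      ultimately show "fourier_coeff f n = 0"
        using R[rule_format, of k] by (simp add: fourier_coeff_T_meas del: of_nat_Suc)
    qed
  qed
  then show ?thesis by (auto simp: Hinf_def)
qed

lemma LINT_cis:
  assumes "n \<noteq> 0"
  shows "(LINT x|T_meas. cis (of_int n * x)) = 0"
proof -
  have int: "set_integrable lebesgue {-pi..pi} (\<lambda>x. cis (of_int n * x))"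
    unfolding set_integrable_def
    using Linf_integrable[OF Linf_cis[of "of_int n"]]
    by (simp add: T_meas_def integrable_restrict_space)
  have "((\<lambda>x. cis (of_int n * x)) has_integral
      (cis (of_int n * pi) / (\<i> * of_int n) - cis (of_int n * - pi) / (\<i> * of_int n))) {-pi..pi}"
  proof (rule fundamental_theorem_of_calculus)
    fix x :: real
    have "((\<lambda>z. exp (\<i> * of_int n * z) / (\<i> * of_int n)) has_field_derivative exp (\<i> * of_int n * of_real x))
        (at (of_real x))"
      using assms by (auto intro!: derivative_eq_intros)
    from has_vector_derivative_real_field[OF this]
    show "((\<lambda>x. cis (of_int n * x) / (\<i> * of_int n)) has_vector_derivative cis (of_int n * x)) (at x within {-pi..pi})"
      by (simp add: cis_conv_exp mult_ac)
  qed simp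
  moreover have "cis (of_int n * pi) = cis (of_int n * - pi)"
    using sin_npi_int[of n] by (simp add: complex_eq_iff mult.commute)
  ultimately have "integral {-pi..pi} (\<lambda>x. cis (of_int n * x)) = 0"
    by (simp add: integral_unique)
  then show ?thesis
    using set_lebesgue_integral_eq_integral(2)[OF int]
    by (simp add: T_meas_def integral_restrict_space set_lebesgue_integral_def)
qed

subsection \<open>Density of trigonometric polynomials\<close>

text \<open>The frequency set is a parameter so that analytic (\<open>{0..}\<close>), antianalytic
  (\<open>{..<0}\<close>) and arbitrary trigonometric polynomials share one induction.\<close>

inductive_set trig_polys :: "int set \<Rightarrow> (real \<Rightarrow> complex) set" for I :: "int set" where
  zero: "(\<lambda>x. 0) \<in> trig_polys I"
| cis_add: "\<lbrakk>n \<in> I; f \<in> trig_polys I\<rbrakk> \<Longrightarrow> (\<lambda>x. c * cis (of_int n * x) + f x) \<in> trig_polys I"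

lemma trig_polys_cis: "n \<in> I \<Longrightarrow> (\<lambda>x. c * cis (of_int n * x)) \<in> trig_polys I"
  using trig_polys.cis_add[OF _ trig_polys.zero, of n I c] by simp

lemma trig_polys_add:
  assumes "f \<in> trig_polys I" "g \<in> trig_polys I"
  shows "(\<lambda>x. f x + g x) \<in> trig_polys I"
  using assms by induction (auto simp: add.assoc intro: trig_polys.cis_add)

lemma trig_polys_mult:
  assumes "f \<in> trig_polys UNIV" "g \<in> trig_polys UNIV"
  shows "(\<lambda>x. f x * g x) \<in> trig_polys UNIV"
proof -
  have *: "(\<lambda>x. c * cis (of_int n * x) * g x) \<in> trig_polys UNIV" for c n
    using assms(2)
  proof induction
    case (cis_add m h d)
    have "(\<lambda>x. c * cis (of_int n * x) * (d * cis (of_int m * x) + h x)) =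
        (\<lambda>x. c * d * cis (of_int (n + m) * x) + c * cis (of_int n * x) * h x)"
      by (simp add: fun_eq_iff algebra_simps flip: cis_mult)
    then show ?case
      using trig_polys.cis_add[OF UNIV_I cis_add.IH, of "c * d" "n + m"] by simp
  qed (simp add: trig_polys.zero)
  show ?thesis
    using assms(1)
  proof induction
    case (cis_add n f c)
    then show ?case
      using trig_polys_add[OF * cis_add.IH] by (simp add: distrib_right)
  qed (simp add: trig_polys.zero)
qed

lemma trig_polys_split:
  assumes "f \<in> trig_polys UNIV"
  obtains g h where "g \<in> trig_polys {0..}" "h \<in> trig_polys {..<0}" "\<And>x. f x = g x + h x"
proof -
  have "\<exists>g\<in>trig_polys {0..}. \<exists>h\<in>trig_polys {..<0}. \<forall>x. f x = g x + h x"
    using assms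
  proof induction
    case zero
    then show ?case by (auto intro!: bexI[OF _ trig_polys.zero])
  next
    case (cis_add n f c)
    then obtain g h where gh: "g \<in> trig_polys {0..}" "h \<in> trig_polys {..<0}" "\<And>x. f x = g x + h x"
      by blast
    show ?case
    proof (cases "n \<ge> 0")
      case True
      then show ?thesis
        using gh by (intro bexI[OF _ trig_polys.cis_add[of n _ g c]] bexI[OF _ gh(2)]) auto
    next
      case False
      then show ?thesis
        using gh by (intro bexI[OF _ trig_polys.cis_add[of n _ h c]] bexI[OF _ gh(1)]) auto
    qed
  qed
  then show thesis using that by blast
qed

lemma trig_polys_Linf: "f \<in> trig_polys I \<Longrightarrow> f \<in> Linf"
  by (induction rule: trig_polys.induct) (auto intro!: Linf_add Linf_mult)

lemma LINT_mult_trig_polys: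
  assumes "F \<in> Linf" "\<And>n. n \<in> I \<Longrightarrow> (LINT x|T_meas. F x * cis (of_int n * x)) = 0"
    and "f \<in> trig_polys I"
  shows "(LINT x|T_meas. F x * f x) = 0"
  using assms(3)
proof induction
  case (cis_add n f c)
  have "integrable T_meas (\<lambda>x. F x * cis (of_int n * x))" "integrable T_meas (\<lambda>x. F x * f x)"
    using assms(1) cis_add trig_polys_Linf by (auto intro!: Linf_integrable)
  then have "(LINT x|T_meas. c * (F x * cis (of_int n * x)) + F x * f x) =
      c * (LINT x|T_meas. F x * cis (of_int n * x)) + (LINT x|T_meas. F x * f x)"
    by simp
  then show ?case
    using cis_add assms(2) by (simp add: algebra_simps)
qed simp

text \<open>Conjugation negates the frequencies, which reduces this to the version without a
  conjugate.\<close>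

lemma LINT_mult_cnj_trig_polys:
  assumes "F \<in> Linf" "\<And>n. n \<in> I \<Longrightarrow> (LINT x|T_meas. F x * cis (- of_int n * x)) = 0"
    and "f \<in> trig_polys I"
  shows "(LINT x|T_meas. F x * cnj (f x)) = 0"
proof -
  have "(\<lambda>x. cnj (f x)) \<in> trig_polys (uminus ` I)"
    using assms(3)
  proof induction
    case (cis_add n f c)
    have "(\<lambda>x. cnj (c * cis (of_int n * x) + f x)) = (\<lambda>x. cnj c * cis (of_int (- n) * x) + cnj (f x))"
      by (simp add: cis_cnj fun_eq_iff)
    then show ?case
      using trig_polys.cis_add[OF _ cis_add.IH, of "- n" "cnj c"] cis_add(1) by simp
  qed (simp add: trig_polys.zero)
  then show ?thesis
    by (rule LINT_mult_trig_polys[OF assms(1), rotated]) (use assms(2) in auto)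
qed

text \<open>Induction on the polynomial: by Euler's formula a real linear functional on the circle
  involves only the frequencies 1 and -1, and trigonometric polynomials are closed under sums and
  products.\<close>

lemma real_polynomial_function_cis:
  fixes p :: "complex \<Rightarrow> real"
  assumes "real_polynomial_function p"
  shows "(\<lambda>x. of_real (p (cis x))) \<in> trig_polys UNIV"
  using assms
proof induction
  case (linear f)
  then interpret bounded_linear f .
  have "f (cis x) = cos x * f 1 + sin x * f \<i>" for x
  proof -
    have "cis x = cos x *\<^sub>R 1 + sin x *\<^sub>R \<i>" by (simp add: complex_eq_iff)
    then show ?thesis by (simp only: add scaleR) simp
  qed
  then have "(\<lambda>x. of_real (f (cis x))) =
      (\<lambda>x. (f 1 - \<i> * f \<i>) / 2 * cis (of_int 1 * x) + (f 1 + \<i> * f \<i>) / 2 * cis (of_int (-1) * x))"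
    by (simp add: fun_eq_iff complex_eq_iff field_simps)
  then show ?case
    by (simp only:) (intro trig_polys.cis_add trig_polys_cis UNIV_I)
next
  case (const c)
  then show ?case using trig_polys_cis[of 0 UNIV "of_real c"] by simp
next
  case (add f g)
  then show ?case using trig_polys_add by fastforce
next
  case (mult f g)
  then show ?case using trig_polys_mult by fastforce
qed

lemma polynomial_function_cis:
  fixes p :: "complex \<Rightarrow> complex"
  assumes "polynomial_function p"
  shows "(\<lambda>x. p (cis x)) \<in> trig_polys UNIV"
proof -
  have "real_polynomial_function (Re \<circ> p)" "real_polynomial_function (Im \<circ> p)"
    using assms bounded_linear_Re bounded_linear_Im by (auto simp: polynomial_function_def)
  note this[THEN real_polynomial_function_cis]
  then have "(\<lambda>x. of_real (Re (p (cis x))) + \<i> * of_real (Im (p (cis x)))) \<in> trig_polys UNIV"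
    using trig_polys_cis[of 0 UNIV \<i>] by (intro trig_polys_add trig_polys_mult) auto
  then show ?thesis by (simp flip: complex_eq)
qed

text \<open>Stone-Weierstrass on the compact set \<open>sphere 0 1\<close>; working with functions
  of the point rather than of the angle builds in periodicity.\<close>

lemma cis_continuous_approx:
  fixes q :: "complex \<Rightarrow> complex"
  assumes "continuous_on (sphere 0 1) q" "e > 0"
  obtains Q where "Q \<in> trig_polys UNIV" "\<And>x. cmod (q (cis x) - Q x) < e"
proof -
  obtain p where "polynomial_function p" "\<forall>w\<in>sphere 0 1. cmod (q w - p w) < e"
    using Stone_Weierstrass_polynomial_function[OF compact_sphere assms] by blast
  then show thesis
    using polynomial_function_cis by (intro that[of "\<lambda>x. p (cis x)"]) auto
qed

text \<open>The factor \<open>1 + Re w\<close> vanishes at the jump of \<open>Arg\<close>.\<close>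

lemma continuous_on_cutoff_Arg:
  fixes g :: "real \<Rightarrow> complex"
  assumes "continuous_on UNIV g" "\<And>x. cmod (g x) \<le> M"
  shows "continuous_on (sphere 0 1) (\<lambda>w. of_real (min 1 (k * (1 + Re w))) * g (Arg w))"
proof -
  let ?q = "\<lambda>w. of_real (min 1 (k * (1 + Re w))) * g (Arg w)"
  have "isCont ?q w" if w: "cmod w = 1" for w
  proof (cases "w \<in> \<real>\<^sub>\<le>\<^sub>0")
    case True
    then have [simp]: "w = -1"
      using w by (auto simp: complex_nonpos_Reals_iff complex_eq_iff cmod_def)
    have "((\<lambda>w. min 1 (k * (1 + Re w)) * M) \<longlongrightarrow> min 1 (k * (1 + Re (-1))) * M) (at (-1))"
      by (intro tendsto_intros)
    then have "((\<lambda>w. \<bar>min 1 (k * (1 + Re w)) * M\<bar>) \<longlongrightarrow> 0) (at (-1))"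
      by (auto intro: tendsto_rabs_zero)
    then have "(?q \<longlongrightarrow> 0) (at (-1))"
    proof (rule Lim_null_comparison[rotated], intro always_eventually allI)
      fix w
      show "cmod (?q w) \<le> \<bar>min 1 (k * (1 + Re w)) * M\<bar>"
        using assms(2)[of "Arg w"] by (auto simp: norm_mult abs_mult intro!: mult_left_mono)
    qed
    then show ?thesis by (simp add: isCont_def)
  next
    case False
    have "isCont g (Arg w)" using assms(1) by (simp add: continuous_on_eq_continuous_at)
    then have "isCont (\<lambda>w. g (Arg w)) w"
      using isCont_o2[OF continuous_at_Arg[OF False]] by blast
    then show ?thesis by (intro continuous_intros linear_continuous_at[OF bounded_linear_Re])
  qed
  then show ?thesis by (intro continuous_at_imp_continuous_on) auto
qed

text \<open>Measurability gives continuous functions converging to \<open>F\<close> almost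
  everywhere. Made bounded and periodic, they converge in L^2 by dominated convergence, and one of
  them is then approximated uniformly by a trigonometric polynomial.\<close>

lemma trig_polys_dense:
  assumes "F \<in> Linf" "e > 0"
  obtains Q where "Q \<in> trig_polys UNIV" "(LINT x|T_meas. (cmod (F x - Q x))\<^sup>2) < e"
proof -
  have F [measurable]: "F \<in> borel_measurable T_meas" using assms by (rule_tac Linf_measurable)
  obtain M where M: "M > 0" "AE x in T_meas. cmod (F x) \<le> M" using assms(1) by (rule LinfE)
  have "F measurable_on {-pi..pi}"
    using F by (simp add: measurable_on_iff_borel_measurable T_meas_def)
  then obtain N g where N: "negligible N" and g: "\<And>n. continuous_on UNIV (g n)"
    and lim: "\<And>x. x \<notin> N \<Longrightarrow> (\<lambda>n. g n x) \<longlonglongrightarrow> (if x \<in> {-pi..pi} then F x else 0)"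
    unfolding measurable_on_def by blast
  \<comment> \<open>Projection onto the ball keeps continuity and fixes the values of
    \<open>F\<close> while giving a uniform bound. The factor with \<open>min\<close> closes the
    function up at the point -1 and tends to 1 elsewhere.\<close>
  let ?r = "closest_point (cball 0 M)"
  define q where "q n w = of_real (min 1 (real n * (1 + Re w))) * ?r (g n (Arg w))" for n w
  have r: "continuous_on UNIV ?r" "\<And>z. cmod (?r z) \<le> M"
    using M(1) closest_point_in_set[of "cball (0::complex) M"]
    by (auto intro!: continuous_on_closest_point simp: dist_norm)
  have qcont: "continuous_on (sphere 0 1) (q n)" for n
    unfolding q_def
    by (rule continuous_on_cutoff_Arg[OF continuous_on_compose2[OF r(1) g]]) (auto intro: r)
  have qbound: "cmod (q n w) \<le> M" if "cmod w = 1" for n w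
  proof -
    have "\<bar>Re w\<bar> \<le> 1" using abs_Re_le_cmod[of w] that by simp
    then have "\<bar>min 1 (real n * (1 + Re w))\<bar> \<le> 1" by auto
    then have "cmod (q n w) \<le> 1 * M"
      unfolding q_def norm_mult by (intro mult_mono r) auto
    then show ?thesis by simp
  qed
  have [measurable]: "(\<lambda>x. q n (cis x)) \<in> borel_measurable T_meas" for n
    by (intro measurable_T_meas borel_measurable_continuous_onI continuous_on_compose2[OF qcont])
      (auto intro: continuous_intros)
  \<comment> \<open>At both endpoints the cutoff factor is 0 for every n, so they join the
    exceptional null set.\<close>
  have "AE x in lebesgue. x \<notin> N \<union> {pi, -pi}"
    using N by (intro AE_not_in) (auto simp: negligible_iff_null_sets[symmetric])
  then have "AE x in T_meas. x \<notin> N \<union> {pi, -pi}" by (rule AE_T_meas_lebesgue)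
  then have qlim: "AE x in T_meas. (\<lambda>n. q n (cis x)) \<longlonglongrightarrow> F x"
    using M(2) AE_space
  proof eventually_elim
    case (elim x)
    then have x: "-pi < x" "x < pi" by auto
    have [simp]: "Arg (cis x) = x"
      using x by (intro Arg_unique[of 1]) (auto simp: cis_conv_exp)
    have "cos x > -1"
      using cos_monotone_0_pi[of "\<bar>x\<bar>" pi] x by simp
    have "\<forall>\<^sub>F n in sequentially. real n \<ge> 1 / (1 + cos x)"
      using filterlim_real_sequentially by (simp add: filterlim_at_top)
    then have ev: "\<forall>\<^sub>F n in sequentially. min 1 (real n * (1 + Re (cis x))) = 1"
      by eventually_elim (use \<open>cos x > -1\<close> in \<open>simp add: field_simps min_def\<close>)
    have "(\<lambda>n. g n x) \<longlonglongrightarrow> F x" using lim[of x] elim x by auto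
    then have "(\<lambda>n. ?r (g n x)) \<longlonglongrightarrow> ?r (F x)"
      by (rule continuous_on_tendsto_compose[OF r(1)]) auto
    moreover have "?r (F x) = F x" using elim by (intro closest_point_self) auto
    ultimately have "(\<lambda>n. of_real 1 * ?r (g n x)) \<longlonglongrightarrow> F x" by simp
    then show ?case
      unfolding q_def by (rule Lim_transform_eventually) (use ev in eventually_elim, simp)
  qed
  have dom: "AE x in T_meas. norm ((cmod (F x - q n (cis x)))\<^sup>2) \<le> (2 * M)\<^sup>2" for n
    using M(2)
  proof eventually_elim
    case (elim x)
    have "cmod (F x - q n (cis x)) \<le> 2 * M"
      using norm_triangle_ineq4[of "F x" "q n (cis x)"] elim qbound[of "cis x" n] by simp
    from power_mono[OF this norm_ge_zero, of 2] show ?case by simp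
  qed
  have "(\<lambda>n. LINT x|T_meas. (cmod (F x - q n (cis x)))\<^sup>2) \<longlonglongrightarrow> (LINT x|T_meas. 0)"
  proof (rule integral_dominated_convergence[where w = "\<lambda>x. (2 * M)\<^sup>2"])
    show "AE x in T_meas. (\<lambda>n. (cmod (F x - q n (cis x)))\<^sup>2) \<longlonglongrightarrow> 0"
      using qlim
    proof eventually_elim
      case (elim x)
      have "(\<lambda>n. (cmod (F x - q n (cis x)))\<^sup>2) \<longlonglongrightarrow> (cmod (F x - F x))\<^sup>2"
        by (intro tendsto_intros elim)
      then show ?case by simp
    qed
  qed (use dom in auto)
  then have "\<forall>\<^sub>F n in sequentially. (LINT x|T_meas. (cmod (F x - q n (cis x)))\<^sup>2) < e / 4"
    using order_tendstoD(2)[of _ 0 sequentially "e / 4"] assms(2) by simp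
  then obtain n where n: "(LINT x|T_meas. (cmod (F x - q n (cis x)))\<^sup>2) < e / 4"
    by (auto simp: eventually_sequentially)
  \<comment> \<open>Chosen so that the uniform error contributes 2 d^2 * 2 pi = e/2; the L^2 error,
    below e/4 and doubled, contributes less than e/2.\<close>
  define d where "d = sqrt (e / (8 * pi))"
  have d: "d > 0" "d\<^sup>2 = e / (8 * pi)" using assms(2) by (auto simp: d_def)
  obtain Q where Q: "Q \<in> trig_polys UNIV" "\<And>x. cmod (q n (cis x) - Q x) < d"
    using cis_continuous_approx[OF qcont d(1)] by blast
  have [measurable]: "Q \<in> borel_measurable T_meas"
    using Q(1) trig_polys_Linf Linf_measurable by blast
  have i1: "integrable T_meas (\<lambda>x. (cmod (F x - q n (cis x)))\<^sup>2)"
    by (rule T.integrable_const_bound[OF dom]) auto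
  have "(LINT x|T_meas. (cmod (F x - Q x))\<^sup>2) \<le> (LINT x|T_meas. 2 * (cmod (F x - q n (cis x)))\<^sup>2 + 2 * d\<^sup>2)"
  proof (rule integral_mono')
    show "integrable T_meas (\<lambda>x. 2 * (cmod (F x - q n (cis x)))\<^sup>2 + 2 * d\<^sup>2)" using i1 by simp
    fix x
    have "cmod (F x - Q x) \<le> cmod (F x - q n (cis x)) + d"
      using norm_triangle_ineq[of "F x - q n (cis x)" "q n (cis x) - Q x"] Q(2)[of x] by simp
    then have "(cmod (F x - Q x))\<^sup>2 \<le> (cmod (F x - q n (cis x)) + d)\<^sup>2" by (simp add: power_mono)
    also have "\<dots> \<le> 2 * (cmod (F x - q n (cis x)))\<^sup>2 + 2 * d\<^sup>2"
      using zero_le_power2[of "cmod (F x - q n (cis x)) - d"] by (simp add: power2_eq_square algebra_simps)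
    finally show "(cmod (F x - Q x))\<^sup>2 \<le> 2 * (cmod (F x - q n (cis x)))\<^sup>2 + 2 * d\<^sup>2" .
  qed auto
  also have "\<dots> = 2 * (LINT x|T_meas. (cmod (F x - q n (cis x)))\<^sup>2) + 2 * d\<^sup>2 * (2 * pi)"
    using i1 by (simp add: measure_T_meas)
  also have "\<dots> < e"
    using n d by (simp add: field_simps)
  finally show thesis using Q(1) that by blast
qed

subsection \<open>Multiplicativity of Poisson integrals\<close>

lemma Hinf_Linf: "f \<in> Hinf \<Longrightarrow> f \<in> Linf"
  by (simp add: Hinf_iff)

lemma LINT_Hinf_cis: "f \<in> Hinf \<Longrightarrow> (LINT x|T_meas. f x * cis (real (Suc n) * x)) = 0"
  by (simp add: Hinf_iff)

lemma Hinf_const [simp]: "(\<lambda>x. c) \<in> Hinf"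
  using LINT_cis[of "int (Suc n)" for n] by (simp add: Hinf_iff)

lemma Hinf_diff:
  assumes "f \<in> Hinf" "g \<in> Hinf"
  shows "(\<lambda>x. f x - g x) \<in> Hinf"
  unfolding Hinf_iff
proof (intro conjI allI)
  show "(\<lambda>x. f x - g x) \<in> Linf" using assms by (auto simp: Hinf_iff)
  fix n
  have "integrable T_meas (\<lambda>x. f x * cis (real (Suc n) * x))"
    "integrable T_meas (\<lambda>x. g x * cis (real (Suc n) * x))"
    by (intro Linf_integrable Linf_mult Linf_cis assms[THEN Hinf_Linf])+
  then show "(LINT x|T_meas. (f x - g x) * cis (real (Suc n) * x)) = 0"
    using assms by (simp add: left_diff_distrib LINT_Hinf_cis del: of_nat_Suc)
qed

lemma Linf_integrable_power2:
  assumes "f \<in> Linf"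
  shows "integrable T_meas (\<lambda>x. (cmod (f x))\<^sup>2)"
  using integrable_Re[OF Linf_integrable[OF Linf_mult[OF assms Linf_cnj[OF assms]]]]
  by (simp only: complex_norm_square[symmetric] Re_complex_of_real)

text \<open>Split an approximant as \<open>Q = g + h\<close> with \<open>h\<close> of negative
  frequencies. Both \<open>F\<close> and \<open>g\<close> are orthogonal to \<open>h\<close>, so
  replacing \<open>Q\<close> by \<open>g\<close> removes the squared norm of \<open>h\<close> from
  the squared error.\<close>

lemma Hinf_dist_nonneg_trig_polys:
  assumes "F \<in> Hinf" "e > 0"
  obtains Q where "Q \<in> trig_polys {0..}" "(LINT x|T_meas. (cmod (F x - Q x))\<^sup>2) < e"
proof -
  obtain Q where Q: "Q \<in> trig_polys UNIV" "(LINT x|T_meas. (cmod (F x - Q x))\<^sup>2) < e"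
    using trig_polys_dense[OF Hinf_Linf[OF assms(1)] assms(2)] .
  obtain g h where gh: "g \<in> trig_polys {0..}" "h \<in> trig_polys {..<0}" "\<And>x. Q x = g x + h x"
    using trig_polys_split[OF Q(1)] by metis
  have L: "F \<in> Linf" "g \<in> Linf" "h \<in> Linf"
    using assms gh by (auto intro: Hinf_Linf trig_polys_Linf)
  have F0: "(LINT x|T_meas. F x * cnj (h x)) = 0"
  proof (rule LINT_mult_cnj_trig_polys[OF L(1) _ gh(2)])
    fix n :: int assume "n \<in> {..<0}"
    then have "n < 0" by simp
    then obtain k where "n = - int (Suc k)" by (metis negD)
    then have "- of_int n = real (Suc k)" by simp
    then show "(LINT x|T_meas. F x * cis (- of_int n * x)) = 0"
      using LINT_Hinf_cis[OF assms(1), of k] by simp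
  qed
  have g0: "(LINT x|T_meas. g x * cnj (h x)) = 0"
  proof (rule LINT_mult_cnj_trig_polys[OF L(2) _ gh(2)])
    fix n :: int assume "n \<in> {..<0}"
    then have n: "n < 0" by simp
    have "(LINT x|T_meas. cis (- of_int n * x) * g x) = 0"
    proof (rule LINT_mult_trig_polys[OF _ _ gh(1)])
      fix m :: int assume "m \<in> {0..}"
      then show "(LINT x|T_meas. cis (- of_int n * x) * cis (of_int m * x)) = 0"
        using LINT_cis[of "m - n"] n by (simp add: cis_mult algebra_simps)
    qed (rule Linf_cis)
    then show "(LINT x|T_meas. g x * cis (- of_int n * x)) = 0" by (simp add: mult.commute)
  qed
  have int: "integrable T_meas (\<lambda>x. F x * cnj (h x))" "integrable T_meas (\<lambda>x. g x * cnj (h x))"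
    by (intro Linf_integrable Linf_mult Linf_cnj L)+
  have "(LINT x|T_meas. (F x - g x) * cnj (h x)) = 0"
    using int F0 g0 by (simp add: left_diff_distrib)
  then have re0: "(LINT x|T_meas. Re ((F x - g x) * cnj (h x))) = 0"
    using int by (subst integral_Re) (auto simp: left_diff_distrib)
  have int': "integrable T_meas (\<lambda>x. Re ((F x - g x) * cnj (h x)))"
    using int by (intro integrable_Re) (simp add: left_diff_distrib)
  \<comment> \<open>The cross term of the expanded square, kept opaque so that its vanishing
    integral can be used as it stands.\<close>
  define X where "X x = Re ((F x - g x) * cnj (h x))" for x
  have "(cmod (F x - Q x))\<^sup>2 = (cmod (F x - g x))\<^sup>2 + (cmod (h x))\<^sup>2 - 2 * X x" for x
    unfolding gh(3) cmod_power2 X_def by (simp add: power2_eq_square algebra_simps)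
  then have "(LINT x|T_meas. (cmod (F x - Q x))\<^sup>2) =
      (LINT x|T_meas. (cmod (F x - g x))\<^sup>2) + (LINT x|T_meas. (cmod (h x))\<^sup>2)"
    using re0 int' Linf_integrable_power2[OF Linf_diff[OF L(1,2)]] Linf_integrable_power2[OF L(3)]
    unfolding X_def[symmetric] by simp
  moreover have "(LINT x|T_meas. (cmod (h x))\<^sup>2) \<ge> 0" by simp
  ultimately show thesis using Q(2) by (intro that[OF gh(1)]) linarith
qed

text \<open>If \<open>Q\<close> has only nonnegative frequencies, then \<open>Q * G\<close> has no
  negative coefficients, since \<open>G\<close> has none. So a negative coefficient of
  \<open>F * G\<close> equals that of \<open>(F - Q) * G\<close>, which is arbitrarily small because
  \<open>G\<close> is bounded.\<close>

lemma Hinf_mult: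
  assumes "F \<in> Hinf" "G \<in> Hinf"
  shows "(\<lambda>x. F x * G x) \<in> Hinf"
  unfolding Hinf_iff
proof (intro conjI allI)
  show "(\<lambda>x. F x * G x) \<in> Linf" using assms by (auto simp: Hinf_iff)
  fix n
  let ?c = "\<lambda>x. cis (real (Suc n) * x)"
  let ?I = "LINT x|T_meas. F x * G x * ?c x"
  obtain B where B: "B > 0" "AE x in T_meas. cmod (G x) \<le> B" using Hinf_Linf[OF assms(2)] by (rule LinfE)
  have bound: "cmod ?I \<le> (B * (pi + 1/2)) * d" if d: "d > 0" for d
  proof -
    obtain Q where Q: "Q \<in> trig_polys {0..}" "(LINT x|T_meas. (cmod (F x - Q x))\<^sup>2) < d\<^sup>2"
      using Hinf_dist_nonneg_trig_polys[OF assms(1), of "d\<^sup>2"] d by auto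
    have L: "F \<in> Linf" "G \<in> Linf" "Q \<in> Linf"
      using assms Q by (auto intro: Hinf_Linf trig_polys_Linf)
    have "(LINT x|T_meas. G x * ?c x * Q x) = 0"
    proof (rule LINT_mult_trig_polys[OF _ _ Q(1)])
      fix m :: int assume "m \<in> {0..}"
      then obtain k where [simp]: "m = int k" using nonneg_int_cases by auto
      have "G x * ?c x * cis (of_int m * x) = G x * cis (real (Suc (n + k)) * x)" for x
        by (simp add: cis_mult algebra_simps)
      then show "(LINT x|T_meas. G x * ?c x * cis (of_int m * x)) = 0"
        using LINT_Hinf_cis[OF assms(2), of "n + k"] by (simp only:)
    qed (use L in auto)
    moreover have i: "integrable T_meas (\<lambda>x. G x * ?c x * Q x)" "integrable T_meas (\<lambda>x. F x * G x * ?c x)"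
      using L by (auto intro!: Linf_integrable Linf_mult)
    ultimately have I: "?I = (LINT x|T_meas. F x * G x * ?c x - G x * ?c x * Q x)" by simp
    have i2: "integrable T_meas (\<lambda>x. (cmod (F x - Q x))\<^sup>2)"
      by (intro Linf_integrable_power2 Linf_diff L)
    have "cmod ?I \<le> (LINT x|T_meas. cmod (F x * G x * ?c x - G x * ?c x * Q x))"
      unfolding I by (rule integral_norm_bound)
    \<comment> \<open>The inequality u \<le> d/2 + u^2/(2d) replaces Cauchy-Schwarz. As the integral
      of u^2 is below d^2, both terms are of order d, which yields the constant
      \<open>B * (pi + 1/2)\<close>.\<close>
    also have "\<dots> \<le> (LINT x|T_meas. B * (d / 2 + (cmod (F x - Q x))\<^sup>2 / (2 * d)))"
    proof (rule integral_mono_AE)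
      show "AE x in T_meas. cmod (F x * G x * ?c x - G x * ?c x * Q x) \<le> B * (d / 2 + (cmod (F x - Q x))\<^sup>2 / (2 * d))"
        using B(2)
      proof eventually_elim
        case (elim x)
        have "F x * G x * ?c x - G x * ?c x * Q x = G x * (F x - Q x) * ?c x" by (simp add: algebra_simps)
        then have "cmod (F x * G x * ?c x - G x * ?c x * Q x) = cmod (G x) * cmod (F x - Q x)"
          by (simp add: norm_mult)
        also have "\<dots> \<le> B * (d / 2 + (cmod (F x - Q x))\<^sup>2 / (2 * d))"
        proof (intro mult_mono elim)
          show "cmod (F x - Q x) \<le> d / 2 + (cmod (F x - Q x))\<^sup>2 / (2 * d)"
            using d zero_le_power2[of "cmod (F x - Q x) - d"] by (simp add: field_simps power2_eq_square)
        qed (use B in auto)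
        finally show ?case .
      qed
    qed (use i i2 in auto)
    also have "\<dots> = B * (d / 2 * (2 * pi) + (LINT x|T_meas. (cmod (F x - Q x))\<^sup>2) / (2 * d))"
      using i2 by (simp add: measure_T_meas)
    also have "\<dots> \<le> B * (d / 2 * (2 * pi) + d\<^sup>2 / (2 * d))"
      using B d Q(2) by (intro mult_left_mono add_left_mono divide_right_mono) auto
    also have "\<dots> = (B * (pi + 1/2)) * d"
      using d by (simp add: field_simps power2_eq_square)
    finally show ?thesis .
  qed
  define K where "K = B * (pi + 1/2)"
  have K: "K > 0" using B by (simp add: K_def add_pos_pos)
  have "cmod ?I \<le> 0"
  proof (rule field_le_epsilon)
    fix e :: real assume "e > 0"
    then show "cmod ?I \<le> 0 + e"
      using bound[of "e / K"] K unfolding K_def[symmetric] by simp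
  qed
  then show "?I = 0" by simp
qed

lemma Hinf_power: "f \<in> Hinf \<Longrightarrow> (\<lambda>x. f x ^ k) \<in> Hinf"
  by (induction k) (auto intro: Hinf_mult)

section \<open>Cauchy and Poisson kernels at a point of the radius towards 1\<close>

definition poisson_kernel :: "real \<Rightarrow> real \<Rightarrow> real" where
  "poisson_kernel \<rho> x = (1 - \<rho>\<^sup>2) / (cmod (1 - of_real \<rho> * cis x))\<^sup>2"

text \<open>Boundary values of the analytic function 1/(1 - \<rho> z). Integration against the
  conjugate, divided by 2 pi, evaluates analytic functions at \<rho>.\<close>

definition cauchy_kernel :: "real \<Rightarrow> real \<Rightarrow> complex" where
  "cauchy_kernel \<rho> x = 1 / (1 - of_real \<rho> * cis x)"

text \<open>The value at \<rho> of the Poisson extension of \<open>f\<close> to the disc.\<close>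

definition poisson_mean :: "real \<Rightarrow> (real \<Rightarrow> complex) \<Rightarrow> complex" where
  "poisson_mean \<rho> f = (LINT x|T_meas. f x * of_real (poisson_kernel \<rho> x)) / of_real (2 * pi)"

context
  fixes \<rho> :: real
  assumes rho: "0 < \<rho>" "\<rho> < 1"
begin

lemma one_minus_cis_bound: "cmod (1 - of_real \<rho> * cis x) \<ge> 1 - \<rho>"
  using norm_triangle_ineq2[of 1 "of_real \<rho> * cis x"] rho by (simp add: norm_mult)

lemma one_minus_cis_nz: "1 - of_real \<rho> * cis x \<noteq> 0"
  using one_minus_cis_bound[of x] rho by force

lemma cauchy_kernel_Linf: "cauchy_kernel \<rho> \<in> Linf"
proof (rule LinfI)
  show "cauchy_kernel \<rho> \<in> borel_measurable T_meas"
    unfolding cauchy_kernel_def by measurable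
  show "cmod (cauchy_kernel \<rho> x) \<le> 1 / (1 - \<rho>)" for x
    using one_minus_cis_bound[of x] rho by (auto simp: cauchy_kernel_def norm_divide intro!: divide_left_mono mult_pos_pos)
qed

text \<open>One step of the geometric series; the recursions below use it in place of a series
  expansion.\<close>

lemma cauchy_kernel_unfold: "cauchy_kernel \<rho> x = 1 + of_real \<rho> * cis x * cauchy_kernel \<rho> x"
  using one_minus_cis_nz[of x] by (simp add: cauchy_kernel_def field_simps)

text \<open>Unfolding the kernel once gives \<open>J n = of_real \<rho> * J (Suc n)\<close>. Since
  all \<open>J n\<close> are bounded by the same \<open>C\<close>, iteration gives the bound
  \<open>\<rho> ^ k * C\<close> for every k, which forces \<open>J n = 0\<close>.\<close>

lemma cauchy_kernel_Hinf: "cauchy_kernel \<rho> \<in> Hinf"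
proof -
  define J where "J n = (LINT x|T_meas. cauchy_kernel \<rho> x * cis (real (Suc n) * x))" for n
  have i: "integrable T_meas (\<lambda>x. cauchy_kernel \<rho> x * cis (real n * x))" for n
    using cauchy_kernel_Linf by (auto intro!: Linf_integrable)
  have J: "J n = of_real \<rho> * J (Suc n)" for n
  proof -
    have "J n = (LINT x|T_meas. cis (of_int (int (Suc n)) * x) + of_real \<rho> * (cauchy_kernel \<rho> x * cis (real (Suc (Suc n)) * x)))"
      unfolding J_def
    proof (intro Bochner_Integration.integral_cong refl)
      fix x
      have "cauchy_kernel \<rho> x * cis (real (Suc n) * x) = (1 + of_real \<rho> * cis x * cauchy_kernel \<rho> x) * cis (real (Suc n) * x)"
        by (subst cauchy_kernel_unfold) simp
      also have "\<dots> = cis (of_int (int (Suc n)) * x) + of_real \<rho> * (cauchy_kernel \<rho> x * (cis x * cis (real (Suc n) * x)))"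
        by (simp add: algebra_simps)
      finally show "cauchy_kernel \<rho> x * cis (real (Suc n) * x) =
          cis (of_int (int (Suc n)) * x) + of_real \<rho> * (cauchy_kernel \<rho> x * cis (real (Suc (Suc n)) * x))"
        by (simp add: cis_mult algebra_simps)
    qed
    also have "\<dots> = (LINT x|T_meas. cis (of_int (int (Suc n)) * x)) + of_real \<rho> * J (Suc n)"
      unfolding J_def using i[of "Suc (Suc n)"] Linf_integrable[OF Linf_cis] by simp
    finally show ?thesis using LINT_cis[of "int (Suc n)"] by simp
  qed
  have Jk: "J n = of_real \<rho> ^ k * J (n + k)" for n k
  proof (induction k)
    case (Suc k)
    then show ?case using J[of "n + k"] by (simp only: add_Suc_right power_Suc2 mult.assoc)
  qed simp
  define C where "C = (LINT x|T_meas. cmod (cauchy_kernel \<rho> x))"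
  have "cmod (J n) \<le> C" for n
    using integral_norm_bound[of T_meas "\<lambda>x. cauchy_kernel \<rho> x * cis (real (Suc n) * x)"]
    by (simp add: J_def C_def norm_mult)
  then have b: "cmod (J n) \<le> \<rho> ^ k * C" for n k
    unfolding Jk[of n k] using rho by (simp add: norm_mult norm_power mult_left_mono)
  have "(\<lambda>k. \<rho> ^ k * C) \<longlonglongrightarrow> 0 * C"
    using rho by (intro tendsto_intros LIMSEQ_power_zero) auto
  then have "cmod (J n) \<le> 0" for n
    using b by (intro LIMSEQ_le_const[of "\<lambda>k. \<rho> ^ k * C"]) auto
  then show ?thesis
    using cauchy_kernel_Linf by (auto simp: Hinf_iff J_def)
qed

lemma LINT_cnj_cauchy_kernel: "(LINT x|T_meas. cnj (cauchy_kernel \<rho> x)) = of_real (2 * pi)"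
proof -
  have "(LINT x|T_meas. cauchy_kernel \<rho> x) = (LINT x|T_meas. 1 + of_real \<rho> * (cauchy_kernel \<rho> x * cis (real (Suc 0) * x)))"
    by (subst cauchy_kernel_unfold) (simp add: mult_ac)
  also have "\<dots> = (LINT x|T_meas. 1) + of_real \<rho> * (LINT x|T_meas. (cauchy_kernel \<rho> x * cis (real (Suc 0) * x)))"
    using Linf_integrable[OF Linf_mult[OF cauchy_kernel_Linf Linf_cis[of 1]]] by simp
  also have "\<dots> = of_real (2 * pi)"
    using LINT_Hinf_cis[OF cauchy_kernel_Hinf, of 0] by (simp add: measure_T_meas scaleR_conv_of_real)
  finally show ?thesis by simp
qed

text \<open>The first identity splits the kernel into an antianalytic part and an analytic part
  vanishing at the origin. In the second, the factor \<open>cis x - of_real \<rho>\<close> cancels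
  the antianalytic denominator, and only positive frequencies remain.\<close>

lemma poisson_kernel_cauchy:
  "of_real (poisson_kernel \<rho> x) = cnj (cauchy_kernel \<rho> x) + of_real \<rho> * cis x * cauchy_kernel \<rho> x" (is ?A)
  "(cis x - of_real \<rho>) * of_real (poisson_kernel \<rho> x) = of_real (1 - \<rho>\<^sup>2) * cis x * cauchy_kernel \<rho> x" (is ?B)
proof -
  have c: "cis x * cnj (cis x) = 1" by (simp add: complex_norm_square[symmetric])
  have nz: "1 - of_real \<rho> * cis x \<noteq> 0" "1 - of_real \<rho> * cnj (cis x) \<noteq> 0"
    using one_minus_cis_nz[of x] one_minus_cis_nz[of "-x"] by (simp_all add: cis_cnj)
  have P: "of_real (poisson_kernel \<rho> x) =
      (1 - of_real \<rho> ^ 2) / ((1 - of_real \<rho> * cis x) * (1 - of_real \<rho> * cnj (cis x)))"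
    unfolding poisson_kernel_def of_real_divide complex_norm_square by simp
  show ?A
    unfolding P cauchy_kernel_def using nz c
    by (simp add: field_simps power2_eq_square)
  have "cis x * (1 - of_real \<rho> * cnj (cis x)) = cis x - of_real \<rho> * (cis x * cnj (cis x))"
    by (simp add: algebra_simps)
  then have "cis x - of_real \<rho> = cis x * (1 - of_real \<rho> * cnj (cis x))"
    unfolding c by simp
  then show ?B
    unfolding P cauchy_kernel_def using nz by simp
qed

lemma poisson_kernel_nonneg: "poisson_kernel \<rho> x \<ge> 0"
  using rho by (simp add: poisson_kernel_def power_le_one)

lemma poisson_kernel_Linf: "(\<lambda>x. of_real (poisson_kernel \<rho> x)) \<in> Linf"
  unfolding poisson_kernel_cauchy(1) using cauchy_kernel_Linf Linf_cis[of 1]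
  by (auto intro!: Linf_add Linf_mult Linf_cnj)

text \<open>The analytic part of the Poisson kernel carries a factor \<open>cis x\<close>, so its
  product with \<open>F\<close> has mean zero.\<close>

lemma poisson_mean_eq_cauchy:
  assumes "F \<in> Hinf"
  shows "of_real (2 * pi) * poisson_mean \<rho> F = (LINT x|T_meas. F x * cnj (cauchy_kernel \<rho> x))"
proof -
  have L: "F \<in> Linf" by (rule Hinf_Linf[OF assms])
  have i: "integrable T_meas (\<lambda>x. F x * cnj (cauchy_kernel \<rho> x))"
    "integrable T_meas (\<lambda>x. F x * cauchy_kernel \<rho> x * cis (real (Suc 0) * x))"
    by (intro Linf_integrable Linf_mult Linf_cnj Linf_cis cauchy_kernel_Linf L)+
  have "(LINT x|T_meas. F x * of_real (poisson_kernel \<rho> x)) =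
     (LINT x|T_meas. F x * cnj (cauchy_kernel \<rho> x) + of_real \<rho> * (F x * cauchy_kernel \<rho> x * cis (real (Suc 0) * x)))"
    unfolding poisson_kernel_cauchy(1) by (simp add: algebra_simps)
  also have "\<dots> = (LINT x|T_meas. F x * cnj (cauchy_kernel \<rho> x))"
    using i LINT_Hinf_cis[OF Hinf_mult[OF assms cauchy_kernel_Hinf], of 0] by simp
  finally show ?thesis by (simp add: poisson_mean_def)
qed

lemma LINT_poisson_kernel: "(LINT x|T_meas. poisson_kernel \<rho> x) = 2 * pi"
proof -
  have "of_real (2 * pi) * poisson_mean \<rho> (\<lambda>x. 1) = of_real (2 * pi)"
    using poisson_mean_eq_cauchy[OF Hinf_const, of 1] LINT_cnj_cauchy_kernel by simp
  then have "complex_of_real (LINT x|T_meas. poisson_kernel \<rho> x) = of_real (2 * pi)"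
    by (simp add: poisson_mean_def)
  then show ?thesis using of_real_eq_iff by blast
qed

text \<open>Subtracting the value at \<rho> removes the pole there. On the circle, dividing by
  \<open>cis x - of_real \<rho>\<close> amounts to multiplying by \<open>cis (- x)\<close> and the
  conjugate Cauchy kernel, whose recursion propagates the vanishing of the coefficients.\<close>

lemma Hinf_divided_difference:
  assumes "G \<in> Hinf"
  shows "(\<lambda>x. (G x - poisson_mean \<rho> G) / (cis x - of_real \<rho>)) \<in> Hinf"
proof -
  define w where "w = poisson_mean \<rho> G"
  let ?k = "\<lambda>x. cnj (cauchy_kernel \<rho> x)"
  have Gw: "(\<lambda>x. G x - w) \<in> Hinf" using assms by (intro Hinf_diff) auto
  have L: "(\<lambda>x. G x - w) \<in> Linf" "G \<in> Linf" using Gw assms by (auto intro: Hinf_Linf)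
  have e: "(G x - w) / (cis x - of_real \<rho>) = (G x - w) * ?k x * cis (- 1 * x)" for x
  proof -
    have "cis x - of_real \<rho> = cis x * (1 - of_real \<rho> * cis (- x))"
      by (simp add: algebra_simps cis_mult)
    then show ?thesis by (simp add: cauchy_kernel_def cis_cnj divide_simps cis_inverse[symmetric])
  qed
  \<comment> \<open>The index starts at frequency 0, not 1, because the factor
    \<open>cis (- x)\<close> lowers each frequency by one. The case \<open>I 0 = 0\<close> is
    exactly the choice of \<open>w\<close>.\<close>
  define I where "I n = (LINT x|T_meas. (G x - w) * ?k x * cis (real n * x))" for n
  have i: "integrable T_meas (\<lambda>x. (G x - w) * ?k x * cis (real n * x))" for n
    by (intro Linf_integrable Linf_mult Linf_cnj Linf_cis cauchy_kernel_Linf L)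
  have "I n = 0" for n
  proof (induction n)
    case 0
    have "I 0 = (LINT x|T_meas. G x * ?k x - w * ?k x)"
      by (simp add: I_def algebra_simps)
    also have "\<dots> = (LINT x|T_meas. G x * ?k x) - w * (LINT x|T_meas. ?k x)"
      using L cauchy_kernel_Linf
      by (subst Bochner_Integration.integral_diff) (auto intro!: Linf_integrable Linf_mult Linf_cnj)
    also have "\<dots> = 0"
      using poisson_mean_eq_cauchy[OF assms] LINT_cnj_cauchy_kernel by (simp add: w_def mult_ac)
    finally show ?case .
  next
    case (Suc n)
    have "I (Suc n) = (LINT x|T_meas. (G x - w) * cis (real (Suc n) * x) + of_real \<rho> * ((G x - w) * ?k x * cis (real n * x)))"
      unfolding I_def
    proof (intro Bochner_Integration.integral_cong refl)
      fix x
      have "?k x = 1 + of_real \<rho> * cis (- x) * ?k x"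
        by (subst cauchy_kernel_unfold) (simp add: cis_cnj)
      then have "(G x - w) * ?k x * cis (real (Suc n) * x) = (G x - w) * (1 + of_real \<rho> * cis (- x) * ?k x) * cis (real (Suc n) * x)"
        by simp
      also have "\<dots> = (G x - w) * cis (real (Suc n) * x) + of_real \<rho> * ((G x - w) * ?k x * (cis (- x) * cis (real (Suc n) * x)))"
        by (simp add: algebra_simps)
      also have "cis (- x) * cis (real (Suc n) * x) = cis (real n * x)"
        by (simp add: cis_mult algebra_simps)
      finally show "(G x - w) * ?k x * cis (real (Suc n) * x) =
        (G x - w) * cis (real (Suc n) * x) + of_real \<rho> * ((G x - w) * ?k x * cis (real n * x))" .
    qed
    also have "\<dots> = (LINT x|T_meas. (G x - w) * cis (real (Suc n) * x)) + of_real \<rho> * I n"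
      unfolding I_def using i[of n] Linf_integrable[OF Linf_mult[OF L(1) Linf_cis[of "real (Suc n)"]]]
      by (subst Bochner_Integration.integral_add) auto
    finally show ?case using Suc LINT_Hinf_cis[OF Gw, of n] by simp
  qed
  then have "(LINT x|T_meas. (G x - w) * ?k x * cis (- 1 * x) * cis (real (Suc n) * x)) = 0" for n
  proof -
    have "(G x - w) * ?k x * cis (- 1 * x) * cis (real (Suc n) * x) = (G x - w) * ?k x * cis (real n * x)" for x
      unfolding mult.assoc cis_mult by (simp add: algebra_simps)
    then show ?thesis using \<open>I n = 0\<close> unfolding I_def by (simp only:)
  qed
  then show ?thesis
    unfolding w_def[symmetric] e Hinf_iff using L cauchy_kernel_Linf
    by (intro conjI allI Linf_mult Linf_cnj Linf_cis) auto
qed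

text \<open>Write G - w = D * (cis x - \<rho>) with \<open>D\<close> in \<open>Hinf\<close>.
  Multiplied by the Poisson kernel, the linear factor becomes analytic and vanishes at the origin,
  so F * (G - w) has Poisson mean 0.\<close>

lemma poisson_mean_mult:
  assumes "F \<in> Hinf" "G \<in> Hinf"
  shows "poisson_mean \<rho> (\<lambda>x. F x * G x) = poisson_mean \<rho> F * poisson_mean \<rho> G"
proof -
  define w where "w = poisson_mean \<rho> G"
  define D where "D x = (G x - w) / (cis x - of_real \<rho>)" for x
  let ?P = "\<lambda>x. complex_of_real (poisson_kernel \<rho> x)"
  have D: "D \<in> Hinf"
    using Hinf_divided_difference[OF assms(2)] by (simp add: D_def[abs_def] w_def)
  have i: "integrable T_meas (\<lambda>x. F x * G x * ?P x)" "integrable T_meas (\<lambda>x. w * (F x * ?P x))"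
    using assms[THEN Hinf_Linf] poisson_kernel_Linf by (auto intro!: Linf_integrable)
  have "F x * G x * ?P x - w * (F x * ?P x) =
      of_real (1 - \<rho>\<^sup>2) * (F x * D x * cauchy_kernel \<rho> x * cis (real (Suc 0) * x))" for x
  proof -
    have "cmod (cis x) \<noteq> cmod (of_real \<rho>)" using rho by simp
    then have "cis x - of_real \<rho> \<noteq> 0" by (metis eq_iff_diff_eq_0)
    then have "G x - w = D x * (cis x - of_real \<rho>)" by (simp add: D_def)
    moreover have "F x * G x * ?P x - w * (F x * ?P x) = F x * (G x - w) * ?P x"
      by (simp add: algebra_simps)
    ultimately have "F x * G x * ?P x - w * (F x * ?P x) = F x * D x * ((cis x - of_real \<rho>) * ?P x)"
      by (simp only: mult.assoc)
    then show ?thesis unfolding poisson_kernel_cauchy(2) by (simp add: mult_ac)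
  qed
  then have "(LINT x|T_meas. F x * G x * ?P x - w * (F x * ?P x)) = 0"
    using LINT_Hinf_cis[OF Hinf_mult[OF Hinf_mult[OF assms(1) D] cauchy_kernel_Hinf], of 0] by simp
  then have "(LINT x|T_meas. F x * G x * ?P x) = w * (LINT x|T_meas. F x * ?P x)"
    using i by simp
  then show ?thesis by (simp add: poisson_mean_def[of _ "\<lambda>x. F x * G x"] poisson_mean_def[of _ F] flip: w_def)
qed

end

subsection \<open>Approximate indicator functions\<close>

lemma poisson_kernel_denominator:
  "(cmod (1 - of_real \<rho> * cis x))\<^sup>2 = (1 - \<rho>)\<^sup>2 + 2 * \<rho> * (1 - cos x)"
proof -
  have "(cmod (1 - of_real \<rho> * cis x))\<^sup>2 = 1 - 2 * \<rho> * cos x + \<rho>\<^sup>2 * ((cos x)\<^sup>2 + (sin x)\<^sup>2)"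
    unfolding cmod_power2
    by (simp add: power2_eq_square algebra_simps del: sin_cos_squared_add sin_cos_squared_add2 sin_cos_squared_add3)
  then show ?thesis by (simp add: power2_eq_square algebra_simps)
qed

text \<open>On the arc of half-width t, 1 - cos x \<le> t^2/2, so the denominator is at most 2 t^2,
  while the numerator is at least t.\<close>

lemma poisson_kernel_ge:
  assumes "0 < t" "t < 1" "\<bar>x\<bar> \<le> t"
  shows "poisson_kernel (1 - t) x \<ge> 1 / (2 * t)"
proof -
  have "1 - cos x = 2 * (sin (x / 2))\<^sup>2" using cos_double_sin[of "x / 2"] by simp
  also have "(sin (x / 2))\<^sup>2 \<le> (t / 2)\<^sup>2"
    using abs_sin_x_le_abs_x[of "x / 2"] assms by (subst abs_le_square_iff[symmetric]) auto
  finally have c: "1 - cos x \<le> t\<^sup>2 / 2" by (simp add: power2_eq_square)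
  have "2 * (1 - t) * (1 - cos x) \<le> 2 * 1 * (t\<^sup>2 / 2)"
    using assms c by (intro mult_mono) auto
  then have "(cmod (1 - of_real (1 - t) * cis x))\<^sup>2 \<le> 2 * t\<^sup>2"
    unfolding poisson_kernel_denominator by simp
  moreover have "cmod (1 - of_real (1 - t) * cis x) > 0"
    using one_minus_cis_bound[of "1 - t" x] assms by linarith
  moreover have "1 - (1 - t)\<^sup>2 \<ge> t"
    using mult_left_mono[of t 1 t] assms by (simp add: power2_eq_square algebra_simps)
  ultimately have "poisson_kernel (1 - t) x \<ge> t / (2 * t\<^sup>2)"
    unfolding poisson_kernel_def using assms by (intro frac_le) auto
  then show ?thesis using assms by (simp add: power2_eq_square)
qed

text \<open>Away from the point 1 the kernel tends uniformly to 0 with t. The condition t \<le> 1/2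
  makes 2 (1 - t) \<ge> 1, so the denominator is at least 1 - cos s.\<close>

lemma poisson_kernel_le:
  assumes "0 < t" "t \<le> 1/2" "0 < s" "s \<le> \<bar>x\<bar>" "\<bar>x\<bar> \<le> pi"
  shows "poisson_kernel (1 - t) x \<le> 2 * t / (1 - cos s)"
proof -
  have "cos \<bar>x\<bar> \<le> cos s" using assms by (intro cos_monotone_0_pi_le) auto
  then have c: "cos x \<le> cos s" by simp
  have s: "cos s < 1" using cos_monotone_0_pi[of 0 s] assms by simp
  have "1 * (1 - cos s) \<le> (2 * (1 - t)) * (1 - cos x)"
    using assms c s by (intro mult_mono) auto
  then have "1 - cos s \<le> (cmod (1 - of_real (1 - t) * cis x))\<^sup>2"
    unfolding poisson_kernel_denominator by (simp add: add_increasing)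
  moreover have "1 - (1 - t)\<^sup>2 \<le> 2 * t" by (simp add: power2_eq_square algebra_simps)
  ultimately show ?thesis
    unfolding poisson_kernel_def using assms s by (intro frac_le) auto
qed

section \<open>Harmonic measure of subsets of the circle\<close>

definition poisson_measure :: "real \<Rightarrow> real set \<Rightarrow> real" where
  "poisson_measure \<rho> E = (LINT x|T_meas. indicator E x * poisson_kernel \<rho> x) / (2 * pi)"

lemma integrable_poisson_kernel:
  assumes "0 < \<rho>" "\<rho> < 1"
  shows "integrable T_meas (poisson_kernel \<rho>)"
  using integrable_Re[OF Linf_integrable[OF poisson_kernel_Linf[OF assms]]] by simp

lemma integrable_indicator_poisson_kernel:
  assumes "0 < \<rho>" "\<rho> < 1" "E \<in> sets T_meas"
  shows "integrable T_meas (\<lambda>x. indicator E x * poisson_kernel \<rho> x)"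
  using integrable_real_mult_indicator[OF assms(3) integrable_poisson_kernel[OF assms(1,2)]]
  by (simp add: mult.commute)

lemma poisson_measure_Compl:
  assumes "0 < \<rho>" "\<rho> < 1" "E \<in> sets T_meas"
  shows "poisson_measure \<rho> ({-pi..pi} - E) = 1 - poisson_measure \<rho> E"
proof -
  have "(LINT x|T_meas. indicator ({-pi..pi} - E) x * poisson_kernel \<rho> x) =
      (LINT x|T_meas. poisson_kernel \<rho> x - indicator E x * poisson_kernel \<rho> x)"
    by (intro Bochner_Integration.integral_cong) (auto simp: indicator_def)
  also have "\<dots> = 2 * pi - (LINT x|T_meas. indicator E x * poisson_kernel \<rho> x)"
    using integrable_poisson_kernel integrable_indicator_poisson_kernel LINT_poisson_kernel assms
    by simp
  finally show ?thesis by (simp add: poisson_measure_def diff_divide_distrib)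
qed

lemma arc_measure_Gamma_arc:
  assumes "0 < t" "t \<le> pi"
  shows "arc_measure (Gamma_arc t) = t / pi"
proof -
  have "Gamma_arc t \<inter> {-pi..pi} = {-t..t}" using assms by (auto simp: Gamma_arc_def)
  then show ?thesis using assms by (simp add: arc_measure_def)
qed

text \<open>The part of \<open>E\<close> in the arc has Lebesgue measure at least 2 a t once the
  normalization is undone, and the kernel is at least 1/(2t) there. The resulting bound does not
  depend on t.\<close>

lemma poisson_measure_ge:
  assumes "0 < t" "t < 1" "E \<in> sets T_meas"
    and "arc_measure (Gamma_arc t \<inter> E) \<ge> a * arc_measure (Gamma_arc t)"
  shows "poisson_measure (1 - t) E \<ge> a / (2 * pi)"
proof -
  let ?A = "Gamma_arc t \<inter> E"
  have "Gamma_arc t = {-pi..pi} \<inter> {-t..t}" by (auto simp: Gamma_arc_def)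
  then have A: "?A \<in> sets T_meas" using assms(3) by (auto simp: sets_T_meas)
  have "?A \<inter> {-pi..pi} = ?A" using A by (auto simp: sets_T_meas)
  then have "measure lebesgue ?A \<ge> a * (t / pi) * (2 * pi)"
    using assms pi_gt3 arc_measure_Gamma_arc[of t] by (simp add: arc_measure_def field_simps)
  then have m: "measure T_meas ?A \<ge> 2 * a * t"
    using A by (subst measure_T_meas) (auto simp: sets_T_meas)
  have "a = 2 * a * t * (1 / (2 * t))" using assms by simp
  also have "\<dots> \<le> measure T_meas ?A * (1 / (2 * t))"
    using m assms by (intro mult_right_mono) auto
  also have "\<dots> = (LINT x|T_meas. indicator ?A x * (1 / (2 * t)))"
    using A sets.sets_into_space[OF A] by (simp add: Int_absorb2)
  also have "\<dots> \<le> (LINT x|T_meas. indicator E x * poisson_kernel (1 - t) x)"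
  proof (rule integral_mono)
    show "integrable T_meas (\<lambda>x. indicator ?A x * (1 / (2 * t)))"
      using A by (intro integrable_mult_left) (simp add: T.emeasure_eq_measure)
    show "integrable T_meas (\<lambda>x. indicator E x * poisson_kernel (1 - t) x)"
      using assms by (intro integrable_indicator_poisson_kernel) auto
    show "indicator ?A x * (1 / (2 * t)) \<le> indicator E x * poisson_kernel (1 - t) x" for x
      using poisson_kernel_ge[of t x] poisson_kernel_nonneg[of "1 - t" x] assms
      by (auto simp: indicator_def Gamma_arc_def)
  qed
  finally show ?thesis by (simp add: poisson_measure_def divide_right_mono)
qed

text \<open>Inside the arc the error is at most \<open>d\<close> against a kernel of mean 1;
  outside, it is at most \<open>C + 1\<close> and the kernel is uniformly small.\<close>

lemma poisson_mean_near_indicator: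
  assumes t: "0 < t" "t \<le> 1/2" and s: "0 < s" and S: "S \<in> sets T_meas"
    and H: "H \<in> Linf" and d: "0 \<le> d" and C: "0 \<le> C"
    and near: "AE x in T_meas. \<bar>x\<bar> \<le> s \<longrightarrow> cmod (H x - indicator S x) \<le> d"
    and bound: "AE x in T_meas. cmod (H x) \<le> C"
  shows "cmod (poisson_mean (1 - t) H - of_real (poisson_measure (1 - t) S)) \<le> d + (C + 1) * (2 * t / (1 - cos s))"
proof -
  let ?P = "poisson_kernel (1 - t)" and ?\<tau> = "2 * t / (1 - cos s)"
  have \<tau>: "?\<tau> \<ge> 0" using t by simp
  have rho: "0 < 1 - t" "1 - t < 1" using t by auto
  have i: "integrable T_meas (\<lambda>x. H x * of_real (?P x))"
    using H poisson_kernel_Linf[OF rho] by (auto intro!: Linf_integrable)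
  have i': "integrable T_meas (\<lambda>x. complex_of_real (indicator S x * ?P x))"
    using integrable_indicator_poisson_kernel[OF rho S] by (simp only: integrable_of_real)
  have "poisson_mean (1 - t) H - of_real (poisson_measure (1 - t) S) =
      (LINT x|T_meas. H x * of_real (?P x) - complex_of_real (indicator S x * ?P x)) / of_real (2 * pi)"
    unfolding poisson_mean_def poisson_measure_def Bochner_Integration.integral_diff[OF i i']
    by (simp add: diff_divide_distrib flip: of_real_mult)
  then have "cmod (poisson_mean (1 - t) H - of_real (poisson_measure (1 - t) S)) =
      cmod (LINT x|T_meas. H x * of_real (?P x) - complex_of_real (indicator S x * ?P x)) / (2 * pi)"
    by (simp add: norm_divide)
  also have "cmod (LINT x|T_meas. H x * of_real (?P x) - complex_of_real (indicator S x * ?P x)) \<le>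
      (LINT x|T_meas. cmod (H x * of_real (?P x) - complex_of_real (indicator S x * ?P x)))"
    by (rule integral_norm_bound)
  also have "\<dots> \<le> (LINT x|T_meas. d * ?P x + (C + 1) * ?\<tau>)"
  proof (rule integral_mono_AE)
    show "integrable T_meas (\<lambda>x. cmod (H x * of_real (?P x) - complex_of_real (indicator S x * ?P x)))"
      using i i' by auto
    show "integrable T_meas (\<lambda>x. d * ?P x + (C + 1) * ?\<tau>)"
      using integrable_poisson_kernel[OF rho] by simp
    show "AE x in T_meas. cmod (H x * of_real (?P x) - complex_of_real (indicator S x * ?P x)) \<le> d * ?P x + (C + 1) * ?\<tau>"
      using near bound AE_space
    proof eventually_elim
      case (elim x)
      have P: "?P x \<ge> 0" by (rule poisson_kernel_nonneg[OF rho])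
      have "H x * of_real (?P x) - complex_of_real (indicator S x * ?P x) = (H x - indicator S x) * of_real (?P x)"
        by (simp add: algebra_simps indicator_def)
      then have e: "cmod (H x * of_real (?P x) - complex_of_real (indicator S x * ?P x)) = cmod (H x - indicator S x) * ?P x"
        using P by (simp add: norm_mult)
      show ?case
      proof (cases "\<bar>x\<bar> \<le> s")
        case True
        then have "cmod (H x - indicator S x) * ?P x \<le> d * ?P x"
          using elim P by (intro mult_right_mono) auto
        moreover have "(C + 1) * ?\<tau> \<ge> 0" using C \<tau> by (intro mult_nonneg_nonneg) auto
        ultimately show ?thesis unfolding e by linarith
      next
        case False
        have "cmod (H x - indicator S x) \<le> cmod (H x) + cmod (indicator S x)"
          by (rule norm_triangle_ineq4)
        also have "\<dots> \<le> C + 1" using elim by (auto simp: indicator_def)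
        finally have "cmod (H x - indicator S x) * ?P x \<le> (C + 1) * ?\<tau>"
          using False elim P t s poisson_kernel_le[of t s x] C by (intro mult_mono) auto
        moreover have "d * ?P x \<ge> 0" using d P by simp
        ultimately show ?thesis unfolding e by linarith
      qed
    qed
  qed
  also have "\<dots> = (d + (C + 1) * ?\<tau>) * (2 * pi)"
    using integrable_poisson_kernel[OF rho] LINT_poisson_kernel[OF rho]
    by (simp add: measure_T_meas algebra_simps)
  finally show ?thesis by (simp add: divide_right_mono)
qed

text \<open>With m the harmonic measure of \<open>S\<close>, the Poisson means A of \<open>h\<close>
  and A^2 of its square are both close to m, so m (1 - m) is small; the densities bound it below by
  the product on the left.\<close>

lemma indicator_density_bound:
  assumes h: "h \<in> Hinf" and S: "S \<in> sets T_meas" and s: "0 < s" "s \<le> pi" and d: "0 \<le> d" "d \<le> 1"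
    and near: "AE x in T_meas. \<bar>x\<bar> \<le> s \<longrightarrow> cmod (h x - indicator S x) \<le> d"
    and \<theta>: "\<And>n. \<theta> n > 0" "\<theta> \<longlonglongrightarrow> 0" and ab: "a > 0" "b > 0"
    and a: "\<And>n. arc_measure (Gamma_arc (\<theta> n) \<inter> S) \<ge> a * arc_measure (Gamma_arc (\<theta> n))"
    and b: "\<And>n. arc_measure (Gamma_arc (\<theta> n) \<inter> ({-pi..pi} - S)) \<ge> b * arc_measure (Gamma_arc (\<theta> n))"
  shows "(a / (2 * pi)) * (b / (2 * pi)) \<le> 6 * d"
proof -
  obtain C where C: "C > 0" "AE x in T_meas. cmod (h x) \<le> C"
    using Hinf_Linf[OF h] by (rule LinfE)
  have h2: "(\<lambda>x. h x * h x) \<in> Hinf" by (rule Hinf_mult[OF h h])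
  \<comment> \<open>Indicators are idempotent, so the error of the square factors as (h - 1_S) (h +
    1_S).\<close>
  have near2: "AE x in T_meas. \<bar>x\<bar> \<le> s \<longrightarrow> cmod (h x * h x - indicator S x) \<le> d * (2 + d)"
    using near
  proof (eventually_elim, intro impI)
    fix x assume "\<bar>x\<bar> \<le> s \<longrightarrow> cmod (h x - indicator S x) \<le> d" "\<bar>x\<bar> \<le> s"
    then have 1: "cmod (h x - indicator S x) \<le> d" by simp
    have "cmod (h x + indicator S x) = cmod (2 * indicator S x + (h x - indicator S x))"
      by (simp add: algebra_simps)
    also have "\<dots> \<le> cmod (2 * indicator S x) + cmod (h x - indicator S x)"
      by (rule norm_triangle_ineq)
    also have "\<dots> \<le> 2 + d" using 1 by (auto simp: indicator_def)
    finally have 2: "cmod (h x + indicator S x) \<le> 2 + d" .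
    have "h x * h x - indicator S x = (h x - indicator S x) * (h x + indicator S x)"
      by (simp add: algebra_simps indicator_def)
    then show "cmod (h x * h x - indicator S x) \<le> d * (2 + d)"
      using 1 2 d by (simp only: norm_mult) (intro mult_mono, auto)
  qed
  have bound2: "AE x in T_meas. cmod (h x * h x) \<le> C * C"
    using C(2) by eventually_elim (use C(1) in \<open>auto simp: norm_mult intro!: mult_mono\<close>)
  define \<tau> where "\<tau> n = 2 * \<theta> n / (1 - cos s)" for n
  \<comment> \<open>\<open>E1\<close> and \<open>E2\<close> bound the distance to m of the Poisson
    means of \<open>h\<close> and of its square; along the sequence they tend to \<open>d\<close>
    and \<open>d * (2 + d)\<close>.\<close>
  define E1 where "E1 n = d + (C + 1) * \<tau> n" for n
  define E2 where "E2 n = d * (2 + d) + (C * C + 1) * \<tau> n" for n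
  have cs: "1 - cos s > 0" using cos_monotone_0_pi[of 0 s] s by simp
  have "\<tau> \<longlonglongrightarrow> 2 * 0 / (1 - cos s)"
    unfolding \<tau>_def[abs_def] using cs by (intro tendsto_intros \<theta>) auto
  then have \<tau>: "\<tau> \<longlonglongrightarrow> 0" by simp
  have "(\<lambda>n. E2 n + E1 n * (2 + E1 n)) \<longlonglongrightarrow>
      (d * (2 + d) + (C * C + 1) * 0) + (d + (C + 1) * 0) * (2 + (d + (C + 1) * 0))"
    unfolding E1_def E2_def by (intro tendsto_intros \<tau>)
  moreover have "\<forall>\<^sub>F n in sequentially. \<theta> n < 1 / 2"
    using order_tendstoD(2)[OF \<theta>(2), of "1 / 2"] by simp
  then have "\<forall>\<^sub>F n in sequentially. (a / (2 * pi)) * (b / (2 * pi)) \<le> E2 n + E1 n * (2 + E1 n)"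
  proof eventually_elim
    case (elim n)
    let ?\<rho> = "1 - \<theta> n"
    have rho: "0 < ?\<rho>" "?\<rho> < 1" using elim \<theta>(1)[of n] by auto
    define m where "m = poisson_measure ?\<rho> S"
    define A where "A = poisson_mean ?\<rho> h"
    have A2: "poisson_mean ?\<rho> (\<lambda>x. h x * h x) = A * A"
      unfolding A_def by (rule poisson_mean_mult[OF rho h h])
    have t: "0 < \<theta> n" "\<theta> n \<le> 1/2" "\<theta> n < 1" using elim \<theta>(1)[of n] by auto
    have m1: "m \<ge> a / (2 * pi)"
      unfolding m_def by (rule poisson_measure_ge[OF t(1,3) S a])
    have "{-pi..pi} - S \<in> sets T_meas" using sets.compl_sets[OF S] by simp
    from poisson_measure_ge[OF t(1,3) this b]
    have m2: "1 - m \<ge> b / (2 * pi)"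
      unfolding m_def by (simp add: poisson_measure_Compl[OF rho S])
    have e1: "cmod (A - of_real m) \<le> E1 n"
      unfolding A_def m_def E1_def \<tau>_def
      using poisson_mean_near_indicator[OF t(1,2) s(1) S Hinf_Linf[OF h] d(1) _ near C(2)] C(1) by simp
    have e2: "cmod (A * A - of_real m) \<le> E2 n"
      unfolding A2[symmetric] m_def E2_def \<tau>_def
      using poisson_mean_near_indicator[OF t(1,2) s(1) S Hinf_Linf[OF h2] _ _ near2 bound2] C(1) d by simp
    have "a / (2 * pi) > 0" "b / (2 * pi) > 0" using ab by auto
    then have m01: "0 \<le> m" "m \<le> 1" using m1 m2 by linarith+
    have "cmod (A + of_real m) = cmod ((A - of_real m) + of_real (2 * m))"
      by (simp add: algebra_simps)
    also have "\<dots> \<le> cmod (A - of_real m) + cmod (of_real (2 * m))" by (rule norm_triangle_ineq)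
    also have "\<dots> \<le> 2 + E1 n" using e1 m01 unfolding norm_of_real by simp
    finally have "cmod (A - of_real m) * cmod (A + of_real m) \<le> E1 n * (2 + E1 n)"
      using e1 order_trans[OF norm_ge_zero e1] by (intro mult_mono) auto
    moreover have "(a / (2 * pi)) * (b / (2 * pi)) \<le> m * (1 - m)"
      using m1 m2 ab m01 by (intro mult_mono) auto
    \<comment> \<open>A^2 is compared with both m^2 and m, whose difference is m (1 - m).\<close>
    moreover have "m * (1 - m) = cmod ((A * A - of_real m * of_real m) - (A * A - of_real m))"
    proof -
      have "(A * A - of_real m * of_real m) - (A * A - of_real m) = of_real (m * (1 - m))"
        by (simp add: algebra_simps)
      then show ?thesis using m01 by (simp only: norm_of_real abs_of_nonneg mult_nonneg_nonneg diff_ge_0_iff_ge)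
    qed
    moreover have "cmod ((A * A - of_real m * of_real m) - (A * A - of_real m)) \<le>
        cmod (A * A - of_real m * of_real m) + cmod (A * A - of_real m)"
      by (rule norm_triangle_ineq4)
    moreover have "cmod (A * A - of_real m * of_real m) = cmod (A - of_real m) * cmod (A + of_real m)"
      by (simp add: algebra_simps flip: norm_mult)
    ultimately show ?case using e2 by linarith
  qed
  ultimately have "(a / (2 * pi)) * (b / (2 * pi)) \<le> d * (2 + d) + d * (2 + d)"
    by (intro tendsto_lowerbound) auto
  \<comment> \<open>The constant 6 comes from 2 (2 + d) with d \<le> 1.\<close>
  also have "\<dots> \<le> 6 * d"
    using d mult_left_mono[of d 1 d] by (simp add: algebra_simps)
  finally show ?thesis .
qed

section \<open>Contradiction from a strictly better antianalytic approximant\<close>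

theorem theorem6:
  fixes \<phi> :: "real \<Rightarrow> complex" and \<theta> :: "nat \<Rightarrow> real" and a b :: real
  assumes "\<phi> \<in> Hinf"
    and "((\<lambda>t. esssup_on (Gamma_arc t \<inter> Lminus \<phi> 1) \<phi>) \<longlongrightarrow> 0) (at_right 0)"
    and "\<And>n. \<theta> n > 0" and "\<theta> \<longlonglongrightarrow> 0"
    and "a > 0" and "b > 0"
    and "\<And>n. arc_measure (Gamma_arc (\<theta> n) \<inter> Lminus \<phi> 1) \<ge> a * arc_measure (Gamma_arc (\<theta> n))"
    and "\<And>n. arc_measure (Gamma_arc (\<theta> n) \<inter> Lplus \<phi> 1) \<ge> b * arc_measure (Gamma_arc (\<theta> n))"
  shows "saturated \<phi>"
proof -
  have \<phi>: "\<phi> \<in> Linf" and [measurable]: "\<phi> \<in> borel_measurable T_meas"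
    using assms(1) Hinf_Linf Linf_measurable by blast+
  define N where "N = norm_inf \<phi>"
  define S where "S = Lminus \<phi> 1"
  have "S = {x \<in> space T_meas. cmod (\<phi> x) < N}" by (simp add: S_def Lminus_def N_def)
  then have S: "S \<in> sets T_meas" by (simp only:) measurable
  have Lp: "Lplus \<phi> 1 = {-pi..pi} - S" by (auto simp: S_def Lminus_def Lplus_def)
  have S_iff: "x \<in> S \<longleftrightarrow> cmod (\<phi> x) < N" if "x \<in> {-pi..pi}" for x
    using that by (auto simp: S_def Lminus_def N_def)
  have phiN: "AE x in T_meas. cmod (\<phi> x) \<le> N" and N0: "N \<ge> 0"
    unfolding N_def by (rule Linf_norm_inf[OF \<phi>])+
  \<comment> \<open>If N were 0, then \<open>S\<close> would be empty and could not fill a positive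
    proportion of the arcs.\<close>
  have "N \<noteq> 0"
  proof
    assume "N = 0"
    then have "S = {}" by (auto simp: S_def Lminus_def N_def[symmetric])
    obtain n where n: "\<theta> n < pi"
      using order_tendstoD(2)[OF assms(4), of pi] by (auto simp: eventually_sequentially)
    then have "arc_measure (Gamma_arc (\<theta> n)) > 0"
      using assms(3)[of n] arc_measure_Gamma_arc[of "\<theta> n"] by simp
    moreover have "arc_measure (Gamma_arc (\<theta> n) \<inter> Lminus \<phi> 1) = 0"
      using \<open>S = {}\<close> by (simp add: S_def arc_measure_def)
    ultimately show False using assms(5) assms(7)[of n] by (simp add: mult_le_0_iff)
  qed
  with N0 have N: "N > 0" by simp
  have key: "N \<le> norm_inf (\<lambda>x. \<phi> x - cnj (f x))" if "f \<in> Hinf0" for f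
  proof (rule ccontr)
    assume "\<not> ?thesis"
    define R where "R = norm_inf (\<lambda>x. \<phi> x - cnj (f x))"
    define r where "r = R / N"
    have f: "f \<in> Hinf" using that by (simp add: Hinf0_def)
    have L: "(\<lambda>x. \<phi> x - cnj (f x)) \<in> Linf" using \<phi> Hinf_Linf[OF f] by auto
    have R: "AE x in T_meas. cmod (\<phi> x - cnj (f x)) \<le> R" and "R \<ge> 0"
      unfolding R_def by (rule Linf_norm_inf[OF L])+
    have r: "0 \<le> r" "r < 1"
      using \<open>R \<ge> 0\<close> N \<open>\<not> N \<le> _\<close> by (auto simp: r_def R_def)
    obtain B where B: "B > 0" "AE x in T_meas. cmod (f x) \<le> B"
      using Hinf_Linf[OF f] by (rule LinfE)
    define \<kappa> where "\<kappa> = (a / (2 * pi)) * (b / (2 * pi))"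
    have \<kappa>: "\<kappa> > 0" using assms(5,6) by (simp add: \<kappa>_def)
    \<comment> \<open>Any d with 6 d < \<kappa> contradicts \<open>indicator_density_bound\<close>,
      which also asks for d \<le> 1.\<close>
    define d where "d = min 1 (\<kappa> / 7)"
    have d: "0 < d" "d \<le> 1" "6 * d < \<kappa>" using \<kappa> by (auto simp: d_def)
    \<comment> \<open>The power k pushes \<open>h\<close> below d where the modulus of \<phi> is N.
      Once k is fixed, continuity at 0 says how small \<open>g\<close> must be on \<open>S\<close>
      for \<open>h\<close> to be within d of 1.\<close>
    obtain k where k: "r ^ k < d" using real_arch_pow_inv[OF d(1) r(2)] by blast
    have "isCont (\<lambda>z::complex. (1 - z) ^ k) 0" by (intro continuous_intros)
    then obtain e where e: "e > 0" "\<And>z::complex. cmod z < e \<Longrightarrow> cmod ((1 - z) ^ k - 1) < d"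
      using d(1) by (force simp: continuous_at_eps_delta dist_norm)
    \<comment> \<open>With \<phi> at most \<epsilon> and \<open>f\<close> at most \<open>B\<close>
      in modulus, \<open>g\<close> is at most e/2.\<close>
    define \<epsilon> where "\<epsilon> = e * N\<^sup>2 / (2 * B)"
    have \<epsilon>: "\<epsilon> > 0" using e B N by (simp add: \<epsilon>_def)
    have "\<forall>\<^sub>F t in at_right 0. esssup_on (Gamma_arc t \<inter> S) \<phi> < ereal \<epsilon> \<and> t < pi"
      using order_tendstoD(2)[OF assms(2), of "ereal \<epsilon>"] \<epsilon>
      by (intro eventually_conj) (auto simp: S_def eventually_at_right_field intro: exI[of _ pi])
    then obtain c where "c > 0" and c: "\<And>t. 0 < t \<Longrightarrow> t < c \<Longrightarrow> esssup_on (Gamma_arc t \<inter> S) \<phi> < ereal \<epsilon> \<and> t < pi"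
      by (auto simp: eventually_at_right_field)
    define s where "s = c / 2"
    have s: "s > 0" "s < pi" "esssup_on (Gamma_arc s \<inter> S) \<phi> < ereal \<epsilon>"
      using c[of s] \<open>c > 0\<close> by (auto simp: s_def)
    have small: "AE x in T_meas. indicator (Gamma_arc s \<inter> S) x * cmod (\<phi> x) \<le> \<epsilon>"
      using esssup_AE[of "\<lambda>x. ereal (indicator (Gamma_arc s \<inter> S) x * cmod (\<phi> x))" T_meas]
    proof eventually_elim
      case (elim x)
      then have "ereal (indicator (Gamma_arc s \<inter> S) x * cmod (\<phi> x)) < ereal \<epsilon>"
        using s(3) unfolding esssup_on_def by (rule order_le_less_trans)
      then show ?case by simp
    qed
    define g where "g x = \<phi> x * f x * of_real (1 / N\<^sup>2)" for x
    define h where "h x = (1 - g x) ^ k" for x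
    have "g \<in> Hinf" unfolding g_def[abs_def] by (intro Hinf_mult assms(1) f Hinf_const)
    then have h: "h \<in> Hinf" unfolding h_def[abs_def] by (intro Hinf_power Hinf_diff Hinf_const)
    have near: "AE x in T_meas. \<bar>x\<bar> \<le> s \<longrightarrow> cmod (h x - indicator S x) \<le> d"
      using R phiN B(2) small AE_space
    proof (eventually_elim, intro impI)
      fix x
      assume x: "cmod (\<phi> x - cnj (f x)) \<le> R" "cmod (\<phi> x) \<le> N" "cmod (f x) \<le> B"
        "indicator (Gamma_arc s \<inter> S) x * cmod (\<phi> x) \<le> \<epsilon>" "x \<in> space T_meas" "\<bar>x\<bar> \<le> s"
      show "cmod (h x - indicator S x) \<le> d"
      proof (cases "x \<in> S")
        case True
        then have "cmod (\<phi> x) \<le> \<epsilon>" using x by (simp add: Gamma_arc_def)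
        then have "cmod (\<phi> x) * cmod (f x) \<le> \<epsilon> * B" using x(3) \<epsilon> by (intro mult_mono) auto
        then have "cmod (g x) \<le> \<epsilon> * B / N\<^sup>2"
          using N by (simp add: g_def norm_mult norm_divide norm_power divide_right_mono)
        also have "\<dots> < e" using N B e by (simp add: \<epsilon>_def field_simps)
        finally show ?thesis using e(2)[of "g x"] True by (simp add: h_def)
      next
        case False
        \<comment> \<open>Off \<open>S\<close> the modulus is at least N, and almost everywhere it
          is at most N.\<close>
        then have n: "cmod (\<phi> x) = N" using S_iff[of x] x by simp
        have "\<phi> x * cnj (\<phi> x) = of_real (N\<^sup>2)" using n complex_norm_square[of "\<phi> x"] by simp
        \<comment> \<open>Since N^2 is \<phi> times its conjugate here, 1 - g contains the conjugate
          of the approximation error as a factor, and its modulus is at most R/N.\<close>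
        then have "1 - g x = \<phi> x * cnj (\<phi> x - cnj (f x)) * of_real (1 / N\<^sup>2)"
          using N by (simp add: g_def field_simps)
        then have "cmod (1 - g x) = N * cmod (\<phi> x - cnj (f x)) / N\<^sup>2"
          using n N by (simp only: norm_mult complex_mod_cnj norm_of_real) simp
        also have "\<dots> \<le> r" using x(1) N by (simp add: r_def power2_eq_square field_simps)
        finally have "cmod (1 - g x) ^ k \<le> r ^ k" by (intro power_mono) auto
        then show ?thesis using k False by (simp add: h_def norm_power)
      qed
    qed
    have "\<kappa> \<le> 6 * d"
      unfolding \<kappa>_def
      using assms(3-8) s d
      by (intro indicator_density_bound[OF h S s(1) _ _ _ near, of \<theta>]) (auto simp: Lp S_def[symmetric])
    with d show False by simp
  qed
  have "(\<lambda>x. 0) \<in> Hinf0"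
    using Hinf_const[of 0] by (simp add: Hinf0_def fourier_coeff_T_meas)
  \<comment> \<open>The zero function attains the lower bound \<open>key\<close>, so the infimum is
    a minimum.\<close>
  then have "N \<in> (\<lambda>f. norm_inf (\<lambda>x. \<phi> x - cnj (f x))) ` Hinf0"
    by (intro image_eqI[of _ _ "\<lambda>x. 0"]) (auto simp: N_def)
  then have "(INF f\<in>Hinf0. norm_inf (\<lambda>x. \<phi> x - cnj (f x))) = N"
    by (rule cInf_eq_minimum) (use key in auto)
  then show ?thesis by (simp add: saturated_def N_def)
qed

end
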